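(* $(\mathsf{DMTS},\chi,\le_{\mathrm{sim}})$ is a specification theory for $\mathsf{LTS}$ which is adequate for simulation equivalence. That is, with $I\models D$ iff $\chi(I)\le_{\mathrm{sim}} D$, for every $I\in\mathsf{LTS}$ the DMTS $\chi(I)$ is a characteristic formula for $I$, and for all $I_1,I_2\in\mathsf{LTS}$, $I_1$ and $I_2$ satisfy exactly the same DMTS iff $I_1$ and $I_2$ are simulation equivalent.
   Context: Fix a finite alphabet $\Sigma$. An LTS is a tuple $(S,s^0,T)$ with $S$ a finite set, $s^0\in S$, $T\subseteq S\times\Sigma\times S$; $\mathsf{LTS}$ is the set of all LTS. A simulation from $(S_1,s^0_1,T_1)$ to $(S_2,s^0_2,T_2)$ is $R\subseteq S_1\times S_2$ with $(s^0_1,s^0_2)\in R$ such that for all $(s_1,s_2)\in R$ and $(s_1,a,t_1)\in T_1$ there is $(s_2,a,t_2)\in T_2$ with $(t_1,t_2)\in R$; two LTS are simulation equivalent if there are simulations in both directions. A DMTS is $D=(S,S^0,\dashrightarrow,\longrightarrow)$ with $S$ finite, $S^0\subseteq S$, $\dashrightarrow\subseteq S\times\Sigma\times S$ (may-transitions, written $s\overset{a}{\dashrightarrow}t$), and $\longrightarrow\subseteq S\times 2^{\Sigma\times S}$ (disjunctive must-transitions, written $s\longrightarrow N$), such that $s\longrightarrow N$ and $(a,t)\in N$ imply $s\overset{a}{\dashrightarrow}t$; $\mathsf{DMTS}$ is the set of all DMTS. For $I=(S,s^0,T)$ let $\chi(I)=(S,\{s^0\},T,\{(s,\{(a,t)\})\mid(s,a,t)\in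 T\})$. For DMTS $D_i=(S_i,S^0_i,\dashrightarrow_i,\longrightarrow_i)$, $D_1\le_{\mathrm{sim}}D_2$ iff there are $R_1,R_2\subseteq S_1\times S_2$ with: (1) every $s^0_1\in S^0_1$ has $s^0_2\in S^0_2$ with $(s^0_1,s^0_2)\in R_1$, and every $s^0_2\in S^0_2$ has $s^0_1\in S^0_1$ with $(s^0_1,s^0_2)\in R_2$; (2) for all $(s_1,s_2)\in R_1$ and $s_1\overset{a}{\dashrightarrow}_1t_1$ there is $s_2\overset{a}{\dashrightarrow}_2t_2$ with $(t_1,t_2)\in R_1$; (3) for all $(s_1,s_2)\in R_2$ and $s_2\longrightarrow_2N_2$ there is $s_1\longrightarrow_1N_1$ such that for every $(a,t_1)\in N_1$ there is $(a,t_2)\in N_2$ with $(t_1,t_2)\in R_2$. A specification theory for a set $\mathsf{Proc}$ is a triple $(\mathsf{Spec},\chi,\le)$, $\chi:\mathsf{Proc}\to\mathsf{Spec}$, $\le$ a preorder on $\mathsf{Spec}$, such that with $I\models S$ iff $\chi(I)\le S$, each $\chi(I)$ is a characteristic formula for $I$: $I\models\chi(I)$, and every $I'\models\chi(I)$ satisfies $\mathrm{Th}(I')=\mathrm{Th}(I)$ where $\mathrm{Th}(I)=\{S\mid I\models S\}$. It is adequate for an equivalence $\sim$ on $\mathsf{Proc}$ if $\mathrm{Th}(I_1)=\mathrm{Th}(I_2)\iff I_1\sim I_2$. *)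

theory Defs imports Main begin

record ('s, 'a) lts =
  lts_states :: "'s set"
  lts_init :: 's
  lts_trans :: "('s \<times> 'a \<times> 's) set"

record ('s, 'a) dmts =
  dmts_states :: "'s set"
  dmts_inits :: "'s set"
  dmts_may :: "('s \<times> 'a \<times> 's) set"
  dmts_must :: "('s \<times> ('a \<times> 's) set) set"

text \<open>The alphabet is an explicit set, so that the empty alphabet is allowed. States are drawn from
  an arbitrary type \<open>'s\<close>, common to processes and specifications. The carriers are arbitrary
  finite subsets of it; for infinite \<open>'s\<close> they include every finite set up to bijection.\<close>

definition LTS :: "'a set \<Rightarrow> ('s, 'a) lts set" where
  "LTS \<Sigma> = {I. finite (lts_states I) \<and> lts_init I \<in> lts_states I
     \<and> lts_trans I \<subseteq> lts_states I \<times> \<Sigma> \<times> lts_states I}"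

definition DMTS :: "'a set \<Rightarrow> ('s, 'a) dmts set" where
  "DMTS \<Sigma> = {D. finite (dmts_states D) \<and> dmts_inits D \<subseteq> dmts_states D
     \<and> dmts_may D \<subseteq> dmts_states D \<times> \<Sigma> \<times> dmts_states D
     \<and> dmts_must D \<subseteq> dmts_states D \<times> Pow (\<Sigma> \<times> dmts_states D)
     \<and> (\<forall>s N a t. (s, N) \<in> dmts_must D \<and> (a, t) \<in> N \<longrightarrow> (s, a, t) \<in> dmts_may D)}"

definition is_simulation ::
    "('s1 \<times> 's2) set \<Rightarrow> ('s1, 'a) lts \<Rightarrow> ('s2, 'a) lts \<Rightarrow> bool" where
  "is_simulation R I1 I2 \<longleftrightarrow>
     R \<subseteq> lts_states I1 \<times> lts_states I2 \<and>
     (lts_init I1, lts_init I2) \<in> R \<and>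
     (\<forall>s1 s2 a t1. (s1, s2) \<in> R \<and> (s1, a, t1) \<in> lts_trans I1 \<longrightarrow>
        (\<exists>t2. (s2, a, t2) \<in> lts_trans I2 \<and> (t1, t2) \<in> R))"

definition sim_equivalent :: "('s1, 'a) lts \<Rightarrow> ('s2, 'a) lts \<Rightarrow> bool" where
  "sim_equivalent I1 I2 \<longleftrightarrow> (\<exists>R. is_simulation R I1 I2) \<and> (\<exists>R. is_simulation R I2 I1)"

definition chi :: "('s, 'a) lts \<Rightarrow> ('s, 'a) dmts" where
  "chi I = \<lparr> dmts_states = lts_states I,
             dmts_inits = {lts_init I},
             dmts_may = lts_trans I,
             dmts_must = {(s, {(a, t)}) | s a t. (s, a, t) \<in> lts_trans I} \<rparr>"

definition le_sim :: "('s1, 'a) dmts \<Rightarrow> ('s2, 'a) dmts \<Rightarrow> bool" where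
  "le_sim D1 D2 \<longleftrightarrow>
     (\<exists>R1 R2.
        R1 \<subseteq> dmts_states D1 \<times> dmts_states D2 \<and>
        R2 \<subseteq> dmts_states D1 \<times> dmts_states D2 \<and>
        (\<forall>i1\<in>dmts_inits D1. \<exists>i2\<in>dmts_inits D2. (i1, i2) \<in> R1) \<and>
        (\<forall>i2\<in>dmts_inits D2. \<exists>i1\<in>dmts_inits D1. (i1, i2) \<in> R2) \<and>
        (\<forall>s1 s2 a t1. (s1, s2) \<in> R1 \<and> (s1, a, t1) \<in> dmts_may D1 \<longrightarrow>
           (\<exists>t2. (s2, a, t2) \<in> dmts_may D2 \<and> (t1, t2) \<in> R1)) \<and>
        (\<forall>s1 s2 N2. (s1, s2) \<in> R2 \<and> (s2, N2) \<in> dmts_must D2 \<longrightarrow>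
           (\<exists>N1. (s1, N1) \<in> dmts_must D1 \<and>
              (\<forall>a t1. (a, t1) \<in> N1 \<longrightarrow> (\<exists>t2. (a, t2) \<in> N2 \<and> (t1, t2) \<in> R2)))))"

definition models ::
    "('p \<Rightarrow> 'd) \<Rightarrow> ('d \<Rightarrow> 'd \<Rightarrow> bool) \<Rightarrow> 'p \<Rightarrow> 'd \<Rightarrow> bool" where
  "models ch le I S \<longleftrightarrow> le (ch I) S"

definition Th ::
    "'d set \<Rightarrow> ('p \<Rightarrow> 'd) \<Rightarrow> ('d \<Rightarrow> 'd \<Rightarrow> bool) \<Rightarrow> 'p \<Rightarrow> 'd set" where
  "Th Spec ch le I = {S \<in> Spec. models ch le I S}"

definition characteristic_formula ::
    "'p set \<Rightarrow> 'd set \<Rightarrow> ('p \<Rightarrow> 'd) \<Rightarrow> ('d \<Rightarrow> 'd \<Rightarrow> bool) \<Rightarrow> 'd \<Rightarrow> 'p \<Rightarrow> bool" where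
  "characteristic_formula Proc Spec ch le S I \<longleftrightarrow>
     models ch le I S \<and>
     (\<forall>I'\<in>Proc. models ch le I' S \<longrightarrow> Th Spec ch le I' = Th Spec ch le I)"

definition specification_theory ::
    "'p set \<Rightarrow> 'd set \<Rightarrow> ('p \<Rightarrow> 'd) \<Rightarrow> ('d \<Rightarrow> 'd \<Rightarrow> bool) \<Rightarrow> bool" where
  "specification_theory Proc Spec ch le \<longleftrightarrow>
     ch ` Proc \<subseteq> Spec \<and>
     reflp_on Spec le \<and> transp_on Spec le \<and>
     (\<forall>I\<in>Proc. characteristic_formula Proc Spec ch le (ch I) I)"

definition adequate_for ::
    "'p set \<Rightarrow> 'd set \<Rightarrow> ('p \<Rightarrow> 'd) \<Rightarrow> ('d \<Rightarrow> 'd \<Rightarrow> bool) \<Rightarrow> ('p \<Rightarrow> 'p \<Rightarrow> bool) \<Rightarrow> bool" where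
  "adequate_for Proc Spec ch le eqv \<longleftrightarrow>
     reflp_on Proc eqv \<and> symp_on Proc eqv \<and> transp_on Proc eqv \<and>
     (\<forall>I1\<in>Proc. \<forall>I2\<in>Proc. Th Spec ch le I1 = Th Spec ch le I2 \<longleftrightarrow> eqv I1 I2)"

end

(* A must-transition of chi I has exactly one target, so reversing the relation R2 of a refinement
   chi I1 <= chi I2 gives a simulation of I2 by I1. Hence chi I1 <= chi I2 holds iff I1 and I2 are
   simulation equivalent, and the order is symmetric on characteristic formulae. Everything else
   follows from the preorder axioms. *)

theory Submission
  imports Defs
begin

text \<open>The conditions that \<open>le_sim\<close> places on \<open>R1\<close>;
  \<open>must_refinement\<close> collects those on \<open>R2\<close>. Separated in this way, each
  half can be composed and specialised to \<open>chi\<close> independently.\<close>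

definition may_refinement ::
    "('s1 \<times> 's2) set \<Rightarrow> ('s1, 'a) dmts \<Rightarrow> ('s2, 'a) dmts \<Rightarrow> bool" where
  "may_refinement R D1 D2 \<longleftrightarrow>
     R \<subseteq> dmts_states D1 \<times> dmts_states D2 \<and>
     (\<forall>i1\<in>dmts_inits D1. \<exists>i2\<in>dmts_inits D2. (i1, i2) \<in> R) \<and>
     (\<forall>s1 s2 a t1. (s1, s2) \<in> R \<and> (s1, a, t1) \<in> dmts_may D1 \<longrightarrow>
        (\<exists>t2. (s2, a, t2) \<in> dmts_may D2 \<and> (t1, t2) \<in> R))"

definition must_refinement ::
    "('s1 \<times> 's2) set \<Rightarrow> ('s1, 'a) dmts \<Rightarrow> ('s2, 'a) dmts \<Rightarrow> bool" where
  "must_refinement R D1 D2 \<longleftrightarrow>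
     R \<subseteq> dmts_states D1 \<times> dmts_states D2 \<and>
     (\<forall>i2\<in>dmts_inits D2. \<exists>i1\<in>dmts_inits D1. (i1, i2) \<in> R) \<and>
     (\<forall>s1 s2 N2. (s1, s2) \<in> R \<and> (s2, N2) \<in> dmts_must D2 \<longrightarrow>
        (\<exists>N1. (s1, N1) \<in> dmts_must D1 \<and>
           (\<forall>a t1. (a, t1) \<in> N1 \<longrightarrow> (\<exists>t2. (a, t2) \<in> N2 \<and> (t1, t2) \<in> R))))"

text \<open>No condition in \<open>le_sim\<close> mentions both relations, so the two existential
  quantifiers can be distributed.\<close>

lemma le_sim_iff_refinements:
  "le_sim D1 D2 \<longleftrightarrow> (\<exists>R. may_refinement R D1 D2) \<and> (\<exists>R. must_refinement R D1 D2)"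
proof -
  have "le_sim D1 D2 \<longleftrightarrow> (\<exists>R1 R2. may_refinement R1 D1 D2 \<and> must_refinement R2 D1 D2)"
    unfolding le_sim_def may_refinement_def must_refinement_def
    by (simp only: conj_ac)
  then show ?thesis by blast
qed

lemma may_refinement_Id_on:
  assumes "D \<in> DMTS \<Sigma>"
  shows "may_refinement (Id_on (dmts_states D)) D D"
proof -
  have "dmts_inits D \<subseteq> dmts_states D" "dmts_may D \<subseteq> dmts_states D \<times> \<Sigma> \<times> dmts_states D"
    using assms by (simp_all add: DMTS_def)
  then show ?thesis
    unfolding may_refinement_def by blast
qed

text \<open>Each must-transition answers itself, with \<open>N1 = N2\<close>. Since
  \<open>Id_on\<close> relates only states of the carrier, the typing of \<open>D\<close> is what
  places the targets in \<open>N\<close> there.\<close>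

lemma must_refinement_Id_on:
  assumes "D \<in> DMTS \<Sigma>"
  shows "must_refinement (Id_on (dmts_states D)) D D"
proof -
  have "N \<subseteq> \<Sigma> \<times> dmts_states D" if "(s, N) \<in> dmts_must D" for s N
    using assms that by (auto simp: DMTS_def)
  moreover have "dmts_inits D \<subseteq> dmts_states D"
    using assms by (simp add: DMTS_def)
  ultimately show ?thesis
    unfolding must_refinement_def by blast
qed

lemma le_sim_refl: "D \<in> DMTS \<Sigma> \<Longrightarrow> le_sim D D"
  unfolding le_sim_iff_refinements
  by (blast intro: may_refinement_Id_on must_refinement_Id_on)

lemma may_refinement_relcomp:
  assumes "may_refinement R D1 D2" and "may_refinement Q D2 D3"
  shows "may_refinement (R O Q) D1 D3"
  unfolding may_refinement_def
proof (intro conjI allI impI ballI)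
  show "R O Q \<subseteq> dmts_states D1 \<times> dmts_states D3"
    using assms unfolding may_refinement_def by blast
  show "\<exists>i3\<in>dmts_inits D3. (i1, i3) \<in> R O Q" if "i1 \<in> dmts_inits D1" for i1
    using assms that unfolding may_refinement_def by (meson relcompI)
  fix s1 s3 a t1
  assume asm: "(s1, s3) \<in> R O Q \<and> (s1, a, t1) \<in> dmts_may D1"
  then obtain s2 where s2: "(s1, s2) \<in> R" "(s2, s3) \<in> Q" by blast
  obtain t2 where t2: "(s2, a, t2) \<in> dmts_may D2" "(t1, t2) \<in> R"
    using assms(1) s2(1) asm unfolding may_refinement_def by meson
  obtain t3 where "(s3, a, t3) \<in> dmts_may D3" "(t2, t3) \<in> Q"
    using assms(2) s2(2) t2(1) unfolding may_refinement_def by meson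
  with t2(2) show "\<exists>t3. (s3, a, t3) \<in> dmts_may D3 \<and> (t1, t3) \<in> R O Q"
    by blast
qed

text \<open>Must-transitions are pulled back from \<open>D3\<close> through \<open>D2\<close> to
  \<open>D1\<close>, whereas their targets are then matched forwards, from \<open>N1\<close> through
  \<open>N2\<close> into \<open>N3\<close>.\<close>

lemma must_refinement_relcomp:
  assumes "must_refinement R D1 D2" and "must_refinement Q D2 D3"
  shows "must_refinement (R O Q) D1 D3"
  unfolding must_refinement_def
proof (intro conjI allI impI ballI)
  show "R O Q \<subseteq> dmts_states D1 \<times> dmts_states D3"
    using assms unfolding must_refinement_def by blast
  show "\<exists>i1\<in>dmts_inits D1. (i1, i3) \<in> R O Q" if "i3 \<in> dmts_inits D3" for i3
    using assms that unfolding must_refinement_def by (meson relcompI)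
  fix s1 s3 N3
  assume asm: "(s1, s3) \<in> R O Q \<and> (s3, N3) \<in> dmts_must D3"
  then obtain s2 where s2: "(s1, s2) \<in> R" "(s2, s3) \<in> Q" by blast
  obtain N2 where N2: "(s2, N2) \<in> dmts_must D2"
    "\<forall>a t2. (a, t2) \<in> N2 \<longrightarrow> (\<exists>t3. (a, t3) \<in> N3 \<and> (t2, t3) \<in> Q)"
    using assms(2) s2(2) asm unfolding must_refinement_def by meson
  obtain N1 where N1: "(s1, N1) \<in> dmts_must D1"
    "\<forall>a t1. (a, t1) \<in> N1 \<longrightarrow> (\<exists>t2. (a, t2) \<in> N2 \<and> (t1, t2) \<in> R)"
    using assms(1) s2(1) N2(1) unfolding must_refinement_def by meson
  show "\<exists>N1. (s1, N1) \<in> dmts_must D1 \<and>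
      (\<forall>a t1. (a, t1) \<in> N1 \<longrightarrow> (\<exists>t3. (a, t3) \<in> N3 \<and> (t1, t3) \<in> R O Q))"
    using N1 N2(2) by (meson relcompI)
qed

lemma le_sim_trans: "le_sim D1 D2 \<Longrightarrow> le_sim D2 D3 \<Longrightarrow> le_sim D1 D3"
  unfolding le_sim_iff_refinements
  by (blast intro: may_refinement_relcomp must_refinement_relcomp)

lemma chi_in_DMTS: "I \<in> LTS \<Sigma> \<Longrightarrow> chi I \<in> DMTS \<Sigma>"
  by (auto simp: LTS_def DMTS_def chi_def)

lemma may_refinement_chi_iff: "may_refinement R (chi I1) (chi I2) \<longleftrightarrow> is_simulation R I1 I2"
  by (simp add: may_refinement_def is_simulation_def chi_def)

text \<open>The free premise \<open>P\<close> stands for \<open>(s1, s2) \<in> R\<close>, so that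
  the equation rewrites the last clause of \<open>must_refinement\<close> directly.\<close>

lemma all_must_chi_iff:
  "(\<forall>N. P \<and> (s, N) \<in> dmts_must (chi I) \<longrightarrow> Q N) \<longleftrightarrow>
    (\<forall>a t. P \<and> (s, a, t) \<in> lts_trans I \<longrightarrow> Q {(a, t)})"
  by (auto simp: chi_def)

text \<open>The set \<open>{(a, t)}\<close> is the one that \<open>all_must_chi_iff\<close>
  substitutes for \<open>N2\<close>. As \<open>N\<close> is a singleton too, its only element must
  carry the label \<open>a\<close> and a target related to \<open>t\<close>.\<close>

lemma ex_must_chi_iff:
  "(\<exists>N. (s, N) \<in> dmts_must (chi I) \<and>
      (\<forall>b u. (b, u) \<in> N \<longrightarrow> (\<exists>v. (b, v) \<in> {(a, t)} \<and> (u, v) \<in> R))) \<longleftrightarrow>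
    (\<exists>u. (s, a, u) \<in> lts_trans I \<and> (u, t) \<in> R)"
  by (auto simp: chi_def)

lemma must_refinement_chi_iff:
  "must_refinement R (chi I1) (chi I2) \<longleftrightarrow> is_simulation (R\<inverse>) I2 I1"
proof -
  have "dmts_states (chi I) = lts_states I" "dmts_inits (chi I) = {lts_init I}"
    for I :: "('s, 'a) lts"
    by (simp_all add: chi_def)
  then show ?thesis
    unfolding must_refinement_def is_simulation_def all_must_chi_iff ex_must_chi_iff
    by (auto simp: chi_def)
qed

lemma le_sim_chi_iff: "le_sim (chi I1) (chi I2) \<longleftrightarrow> sim_equivalent I1 I2"
proof -
  \<comment> \<open>Converse is an involution, so every relation is of the form
    \<open>R\<inverse>\<close>.\<close>
  have "(\<exists>R. is_simulation (R\<inverse>) I2 I1) \<longleftrightarrow> (\<exists>R. is_simulation R I2 I1)"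
    by (metis converse_converse)
  then show ?thesis
    by (simp add: le_sim_iff_refinements sim_equivalent_def may_refinement_chi_iff
        must_refinement_chi_iff)
qed

lemma sim_equivalent_sym: "sim_equivalent I1 I2 \<Longrightarrow> sim_equivalent I2 I1"
  by (auto simp: sim_equivalent_def)

lemma Th_eq_iff:
  assumes "I1 \<in> LTS \<Sigma>" and "I2 \<in> LTS \<Sigma>"
  shows "Th (DMTS \<Sigma>) chi le_sim I1 = Th (DMTS \<Sigma>) chi le_sim I2 \<longleftrightarrow> sim_equivalent I1 I2"
proof
  assume "Th (DMTS \<Sigma>) chi le_sim I1 = Th (DMTS \<Sigma>) chi le_sim I2"
  \<comment> \<open>By reflexivity \<open>chi I2\<close> lies in the theory of \<open>I2\<close>,
    hence in that of \<open>I1\<close>.\<close>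
  then have "le_sim (chi I1) (chi I2)"
    using le_sim_refl[OF chi_in_DMTS[OF assms(2)]] chi_in_DMTS[OF assms(2)]
    by (auto simp: Th_def models_def)
  then show "sim_equivalent I1 I2" by (simp add: le_sim_chi_iff)
next
  assume "sim_equivalent I1 I2"
  \<comment> \<open>Symmetry of simulation equivalence supplies the second comparison. By
    transitivity each of the two yields one inclusion between the theories.\<close>
  then have "le_sim (chi I1) (chi I2)" "le_sim (chi I2) (chi I1)"
    by (simp_all add: le_sim_chi_iff sim_equivalent_sym)
  then show "Th (DMTS \<Sigma>) chi le_sim I1 = Th (DMTS \<Sigma>) chi le_sim I2"
    by (auto simp: Th_def models_def intro: le_sim_trans)
qed

theorem theorem1:
  fixes \<Sigma> :: "'a set"
  assumes "finite \<Sigma>"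
  shows "specification_theory (LTS \<Sigma> :: ('s, 'a) lts set) (DMTS \<Sigma>) chi le_sim
    \<and> adequate_for (LTS \<Sigma> :: ('s, 'a) lts set) (DMTS \<Sigma>) chi le_sim sim_equivalent"
proof
  show "specification_theory (LTS \<Sigma> :: ('s, 'a) lts set) (DMTS \<Sigma>) chi le_sim"
    unfolding specification_theory_def
  proof (intro conjI ballI)
    show "reflp_on (DMTS \<Sigma>) le_sim"
      by (auto intro: reflp_onI le_sim_refl)
    show "transp_on (DMTS \<Sigma>) le_sim"
      by (blast intro: transp_onI le_sim_trans)
  \<comment> \<open>\<open>Th_eq_iff\<close> reduces equality of theories to
    \<open>sim_equivalent I' I\<close>, which the reversed \<open>le_sim_chi_iff\<close> turns into
    the assumption that \<open>I'\<close> models \<open>chi I\<close>.\<close>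
  qed (auto simp: characteristic_formula_def models_def le_sim_chi_iff[symmetric] Th_eq_iff
        intro: chi_in_DMTS le_sim_refl)
  \<comment> \<open>Reflexivity, and likewise transitivity below, is pulled back from
    \<open>le_sim\<close> along \<open>chi\<close>.\<close>
  have "reflp_on (LTS \<Sigma>) sim_equivalent"
    unfolding le_sim_chi_iff[symmetric] by (blast intro: reflp_onI le_sim_refl chi_in_DMTS)
  moreover have "symp_on (LTS \<Sigma>) sim_equivalent"
    by (blast intro: symp_onI sim_equivalent_sym)
  moreover have "transp_on (LTS \<Sigma>) sim_equivalent"
    unfolding le_sim_chi_iff[symmetric] by (blast intro: transp_onI le_sim_trans)
  ultimately show "adequate_for (LTS \<Sigma> :: ('s, 'a) lts set) (DMTS \<Sigma>) chi le_sim sim_equivalent"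
    by (simp add: adequate_for_def Th_eq_iff)
qed

end
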